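(* Let $\Omega$ be a set and $\mathcal{P}$ a (not necessarily finite) patchwork on $\Omega$. The following are equivalent: (a) $\Omega$ admits a total ordering $\leq$ under which all members of $\mathcal{P}$ are convex; (b) no three nonempty members of $\mathcal{P}$ are pairwise adjacent.
   Context: A subset $A$ of a totally ordered set $(\Omega,\leq)$ is convex if $p\leq q\leq r$ with $p,r\in A$ implies $q\in A$. Subsets $A,B\subseteq\Omega$ overlap if $A\cap B\neq\emptyset$ but neither contains the other. A patchwork on $\Omega$ is a set $\mathcal{P}$ of subsets of $\Omega$ such that $\emptyset,\Omega\in\mathcal{P}$ and for every pair of overlapping $A,B\in\mathcal{P}$, the sets $A\cap B$, $A\cup B$, $A\setminus B$ belong to $\mathcal{P}$. Two members of $\mathcal{P}$ are adjacent if they are disjoint and their union is again a member of $\mathcal{P}$. *)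

theory Defs
  imports Main
begin

definition convex_in :: "'a rel \<Rightarrow> 'a set \<Rightarrow> bool" where
  "convex_in r A \<longleftrightarrow>
     (\<forall>p q s. p \<in> A \<longrightarrow> s \<in> A \<longrightarrow> (p, q) \<in> r \<longrightarrow> (q, s) \<in> r \<longrightarrow> q \<in> A)"

definition overlap :: "'a set \<Rightarrow> 'a set \<Rightarrow> bool" where
  "overlap A B \<longleftrightarrow> A \<inter> B \<noteq> {} \<and> \<not> A \<subseteq> B \<and> \<not> B \<subseteq> A"

definition patchwork :: "'a set \<Rightarrow> 'a set set \<Rightarrow> bool" where
  "patchwork \<Omega> \<P> \<longleftrightarrow>
     \<P> \<subseteq> Pow \<Omega> \<and> {} \<in> \<P> \<and> \<Omega> \<in> \<P> \<and>
     (\<forall>A\<in>\<P>. \<forall>B\<in>\<P>. overlap A B \<longrightarrow>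
        A \<inter> B \<in> \<P> \<and> A \<union> B \<in> \<P> \<and> A - B \<in> \<P>)"

definition adjacent :: "'a set set \<Rightarrow> 'a set \<Rightarrow> 'a set \<Rightarrow> bool" where
  "adjacent \<P> A B \<longleftrightarrow> A \<in> \<P> \<and> B \<in> \<P> \<and> A \<inter> B = {} \<and> A \<union> B \<in> \<P>"

end

theory Submission
  imports Defs
begin

text \<open>
  Both conditions are equivalent to the absence of a tripod: members \<open>D, E, F\<close> such that any two of
  them meet outside the third. Among three points of a total order one lies between the other two, so
  convex sets form no tripod. Three pairwise adjacent members have a tripod as their pairwise unions;
  conversely, the three sets \<open>D \<inter> E - F\<close>, \<open>E \<inter> F - D\<close>, \<open>D \<inter> F - E\<close> of a tripod are pairwise adjacent.

  Let no tripod exist. By compactness and by passing to traces, the ground set may be assumed finite.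
  Let \<open>x\<close> and \<open>y\<close> be points of a minimal member with at least two points. Order the set without \<open>y\<close> by
  induction and insert \<open>y\<close> next to \<open>x\<close>. The members that might fail to be convex are those which
  contain exactly one of \<open>x\<close>, \<open>y\<close> and some third point, and by minimality these occur only if
  \<open>{x, y}\<close> is a member. Without \<open>x\<close> and \<open>y\<close>, each of them lies on one side of \<open>x\<close>, and two of them lie
  on the same side iff they meet there, which in the absence of tripods means that they contain the
  same point of \<open>{x, y}\<close>. Hence \<open>y\<close> fits on one side of \<open>x\<close>.
\<close>

subsection \<open>Linear orders\<close>

lemma linear_order_onD:
  assumes "linear_order_on X r"
  shows linear_order_on_subset: "r \<subseteq> X \<times> X"
    and linear_order_on_refl: "p \<in> X \<Longrightarrow> (p, p) \<in> r"
    and linear_order_on_trans: "(p, q) \<in> r \<Longrightarrow> (q, s) \<in> r \<Longrightarrow> (p, s) \<in> r"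
    and linear_order_on_antisym: "(p, q) \<in> r \<Longrightarrow> (q, p) \<in> r \<Longrightarrow> p = q"
    and linear_order_on_total: "p \<in> X \<Longrightarrow> q \<in> X \<Longrightarrow> (p, q) \<in> r \<or> (q, p) \<in> r"
proof -
  have order: "r \<subseteq> X \<times> X" "refl_on X r" "trans r" "antisym r" "total_on X r"
    using assms unfolding order_on_defs by blast+
  show "r \<subseteq> X \<times> X" by (fact order)
  show "p \<in> X \<Longrightarrow> (p, p) \<in> r" by (rule refl_onD[OF order(2)])
  show "(p, q) \<in> r \<Longrightarrow> (q, s) \<in> r \<Longrightarrow> (p, s) \<in> r" by (rule transD[OF order(3)])
  show "(p, q) \<in> r \<Longrightarrow> (q, p) \<in> r \<Longrightarrow> p = q" by (rule antisymD[OF order(4)])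
  show "(p, q) \<in> r \<or> (q, p) \<in> r" if "p \<in> X" "q \<in> X"
    using that order(2,5) unfolding refl_on_def total_on_def by metis
qed

lemma linear_order_onI:
  assumes "r \<subseteq> X \<times> X"
    and "\<And>p q s. (p, q) \<in> r \<Longrightarrow> (q, s) \<in> r \<Longrightarrow> (p, s) \<in> r"
    and "\<And>p q. (p, q) \<in> r \<Longrightarrow> (q, p) \<in> r \<Longrightarrow> p = q"
    and "\<And>p q. p \<in> X \<Longrightarrow> q \<in> X \<Longrightarrow> (p, q) \<in> r \<or> (q, p) \<in> r"
  shows "linear_order_on X r"
  using assms unfolding order_on_defs refl_on_def total_on_def trans_def antisym_def by blast

lemma linear_order_on_Restr_subset:
  assumes "linear_order_on X r" "Y \<subseteq> X"
  shows "linear_order_on Y (Restr r Y)"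
  using assms unfolding order_on_defs refl_on_def total_on_def
  by (auto intro: trans_Restr antisym_Restr) blast

lemma linear_order_on_if_finite_Restr:
  assumes sub: "r \<subseteq> X \<times> X"
    and Restr: "\<And>Y. finite Y \<Longrightarrow> Y \<subseteq> X \<Longrightarrow> linear_order_on Y (Restr r Y)"
  shows "linear_order_on X r"
proof (rule linear_order_onI)
  show "(p, s) \<in> r" if "(p, q) \<in> r" "(q, s) \<in> r" for p q s
    using that sub linear_order_on_trans[OF Restr[of "{p, q, s}"], of p q s] by auto
  show "p = q" if "(p, q) \<in> r" "(q, p) \<in> r" for p q
    using that sub linear_order_on_antisym[OF Restr[of "{p, q}"], of p q] by auto
  show "(p, q) \<in> r \<or> (q, p) \<in> r" if "p \<in> X" "q \<in> X" for p q
    using that linear_order_on_total[OF Restr[of "{p, q}"], of p q] by auto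
qed (fact sub)

lemma linear_order_on_eq_if_total_subset:
  assumes s: "linear_order_on X s" and "r \<subseteq> s"
    and total: "\<And>p q. p \<in> X \<Longrightarrow> q \<in> X \<Longrightarrow> (p, q) \<in> r \<or> (q, p) \<in> r"
  shows "r = s"
proof
  show "s \<subseteq> r"
  proof clarify
    fix p q assume pq: "(p, q) \<in> s"
    then have "(p, q) \<in> r \<or> (q, p) \<in> r"
      using total linear_order_on_subset[OF s] by blast
    then show "(p, q) \<in> r"
      using pq \<open>r \<subseteq> s\<close> linear_order_on_antisym[OF s pq] by blast
  qed
qed (fact \<open>r \<subseteq> s\<close>)

lemma underS_converse [simp]: "underS (r\<inverse>) x = aboveS r x"
  unfolding underS_def aboveS_def by auto

lemma aboveS_converse [simp]: "aboveS (r\<inverse>) x = underS r x"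
  unfolding underS_def aboveS_def by auto

lemma underS_Int_aboveS:
  assumes "linear_order_on X r"
  shows "underS r x \<inter> aboveS r x = {}"
  using linear_order_on_antisym[OF assms] unfolding underS_def aboveS_def by blast

definition insert_after :: "'a rel \<Rightarrow> 'a \<Rightarrow> 'a \<Rightarrow> 'a rel" where
  "insert_after r x y = r \<union> insert y (under r x) \<times> {y} \<union> {y} \<times> aboveS r x"

lemma insert_after_iff:
  "(p, q) \<in> insert_after r x y \<longleftrightarrow>
     (p, q) \<in> r \<or> q = y \<and> (p = y \<or> (p, x) \<in> r) \<or> p = y \<and> q \<noteq> x \<and> (x, q) \<in> r"
  unfolding insert_after_def under_def aboveS_def by auto

lemma linear_order_on_insert_after:
  assumes r: "linear_order_on X r" "x \<in> X" "y \<notin> X"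
  shows "linear_order_on (insert y X) (insert_after r x y)"
proof (rule linear_order_onI)
  note insert_after_iff [simp]
  have dom: "p \<in> X" "q \<in> X" "p \<noteq> y" "q \<noteq> y" if "(p, q) \<in> r" for p q
    using that linear_order_on_subset[OF r(1)] r(3) by blast+
  show "insert_after r x y \<subseteq> insert y X \<times> insert y X"
    using dom by auto
  show "(p, s) \<in> insert_after r x y"
    if "(p, q) \<in> insert_after r x y" "(q, s) \<in> insert_after r x y" for p q s
    using that dom linear_order_on_trans[OF r(1)] linear_order_on_antisym[OF r(1)]
    by simp metis
  show "p = q" if "(p, q) \<in> insert_after r x y" "(q, p) \<in> insert_after r x y" for p q
    using that dom linear_order_on_antisym[OF r(1)] by simp metis
  show "(p, q) \<in> insert_after r x y \<or> (q, p) \<in> insert_after r x y"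
    if "p \<in> insert y X" "q \<in> insert y X" for p q
    using that r(2) linear_order_on_total[OF r(1)] by simp metis
qed

subsection \<open>Compactness\<close>

definition finite_character :: "('a set \<Rightarrow> bool) \<Rightarrow> bool" where
  "finite_character Q \<longleftrightarrow> (\<forall>S. Q S \<longleftrightarrow> (\<forall>F. finite F \<longrightarrow> F \<subseteq> S \<longrightarrow> Q F))"

lemma finite_character_antimono:
  "finite_character Q \<Longrightarrow> Q T \<Longrightarrow> S \<subseteq> T \<Longrightarrow> Q S"
  unfolding finite_character_def by (meson subset_trans)

definition extends_on :: "('a rel \<Rightarrow> bool) \<Rightarrow> 'a rel \<Rightarrow> 'a set \<Rightarrow> bool" where
  "extends_on Q L X \<longleftrightarrow> (\<exists>r. linear_order_on X r \<and> Restr L X \<subseteq> r \<and> Q r)"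

definition finitely_extendable :: "'a set \<Rightarrow> ('a rel \<Rightarrow> bool) \<Rightarrow> 'a rel \<Rightarrow> bool" where
  "finitely_extendable \<Omega> Q L \<longleftrightarrow>
     L \<subseteq> \<Omega> \<times> \<Omega> \<and> (\<forall>X. finite X \<longrightarrow> X \<subseteq> \<Omega> \<longrightarrow> extends_on Q L X)"

lemma extends_on_subset:
  assumes Q: "finite_character Q" and "extends_on Q L X" "Y \<subseteq> X"
  shows "extends_on Q L Y"
proof -
  obtain r where r: "linear_order_on X r" "Restr L X \<subseteq> r" "Q r"
    using assms(2) unfolding extends_on_def by blast
  have "linear_order_on Y (Restr r Y)" by (rule linear_order_on_Restr_subset[OF r(1) \<open>Y \<subseteq> X\<close>])
  moreover have "Restr L Y \<subseteq> Restr r Y" using r(2) \<open>Y \<subseteq> X\<close> by blast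
  moreover have "Q (Restr r Y)" by (rule finite_character_antimono[OF Q r(3) Int_lower1])
  ultimately show ?thesis unfolding extends_on_def by blast
qed

lemma finitely_extendable_Union_chain:
  assumes "subset.chain {L. finitely_extendable \<Omega> Q L} \<C>" "\<C> \<noteq> {}"
  shows "finitely_extendable \<Omega> Q (\<Union>\<C>)"
  unfolding finitely_extendable_def
proof (intro conjI allI impI)
  have ext: "finitely_extendable \<Omega> Q L" if "L \<in> \<C>" for L
    using assms(1) that unfolding subset.chain_def by blast
  then show "\<Union>\<C> \<subseteq> \<Omega> \<times> \<Omega>" unfolding finitely_extendable_def by blast
  fix X assume X: "finite X" "X \<subseteq> \<Omega>"
  then have "finite (Restr (\<Union>\<C>) X)" by blast
  then obtain L where L: "L \<in> \<C>" "Restr (\<Union>\<C>) X \<subseteq> L"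
    by (rule finite_subset_Union_chain[OF _ Int_lower1 assms(2,1)])
  have "extends_on Q L X"
    using ext[OF L(1)] X unfolding finitely_extendable_def by blast
  then show "extends_on Q (\<Union>\<C>) X"
    using L(2) unfolding extends_on_def by blast
qed

lemma finitely_extendable_insert:
  assumes Q: "finite_character Q" and L: "finitely_extendable \<Omega> Q L" and pq: "p \<in> \<Omega>" "q \<in> \<Omega>"
  shows "finitely_extendable \<Omega> Q (insert (p, q) L) \<or> finitely_extendable \<Omega> Q (insert (q, p) L)"
proof (rule ccontr)
  assume "\<not> ?thesis"
  then obtain X Y where X: "finite X" "X \<subseteq> \<Omega>" "\<not> extends_on Q (insert (p, q) L) X"
    and Y: "finite Y" "Y \<subseteq> \<Omega>" "\<not> extends_on Q (insert (q, p) L) Y"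
    using L pq unfolding finitely_extendable_def by blast
  define Z where "Z = {p, q} \<union> X \<union> Y"
  then have Z: "p \<in> Z" "q \<in> Z" "X \<subseteq> Z" "Y \<subseteq> Z" by blast+
  have "finite Z" "Z \<subseteq> \<Omega>" using X(1,2) Y(1,2) pq unfolding Z_def by auto
  then obtain r where r: "linear_order_on Z r" "Restr L Z \<subseteq> r" "Q r"
    using L unfolding finitely_extendable_def extends_on_def by blast
  consider (forward) "(p, q) \<in> r" | (backward) "(q, p) \<in> r"
    using linear_order_on_total[OF r(1) Z(1,2)] by blast
  then show False
  proof cases
    case forward
    then have "extends_on Q (insert (p, q) L) Z" using r unfolding extends_on_def by blast
    then show False using X(3) extends_on_subset[OF Q _ Z(3)] by blast
  next
    case backward
    then have "extends_on Q (insert (q, p) L) Z" using r unfolding extends_on_def by blast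
    then show False using Y(3) extends_on_subset[OF Q _ Z(4)] by blast
  qed
qed

lemma ex_maximal_finitely_extendable:
  assumes "finitely_extendable \<Omega> Q L"
  obtains M where "finitely_extendable \<Omega> Q M"
    and "\<And>L. finitely_extendable \<Omega> Q L \<Longrightarrow> M \<subseteq> L \<Longrightarrow> L = M"
proof -
  have "\<exists>M\<in>{L. finitely_extendable \<Omega> Q L}. \<forall>L\<in>{L. finitely_extendable \<Omega> Q L}. M \<subseteq> L \<longrightarrow> L = M"
    using assms by (intro subset_Zorn_nonempty) (auto intro: finitely_extendable_Union_chain)
  then show thesis using that by blast
qed

lemma linear_order_on_compactness:
  assumes Q: "finite_character Q"
    and finite: "\<And>X. finite X \<Longrightarrow> X \<subseteq> \<Omega> \<Longrightarrow> \<exists>r. linear_order_on X r \<and> Q r"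
  shows "\<exists>r. linear_order_on \<Omega> r \<and> Q r"
proof -
  have "finitely_extendable \<Omega> Q {}"
    using finite unfolding finitely_extendable_def extends_on_def by blast
  from ex_maximal_finitely_extendable[OF this] obtain M where M: "finitely_extendable \<Omega> Q M"
    and maximal: "\<And>L. finitely_extendable \<Omega> Q L \<Longrightarrow> M \<subseteq> L \<Longrightarrow> L = M"
    by blast
  have sub: "M \<subseteq> \<Omega> \<times> \<Omega>" using M unfolding finitely_extendable_def by blast
  have total: "(p, q) \<in> M \<or> (q, p) \<in> M" if "p \<in> \<Omega>" "q \<in> \<Omega>" for p q
    using finitely_extendable_insert[OF Q M that] maximal by blast
  have Restr: "linear_order_on X (Restr M X)" "Q (Restr M X)" if X: "finite X" "X \<subseteq> \<Omega>" for X
  proof -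
    obtain r where r: "linear_order_on X r" "Restr M X \<subseteq> r" "Q r"
      using M X unfolding finitely_extendable_def extends_on_def by blast
    then have "Restr M X = r"
      using total X by (intro linear_order_on_eq_if_total_subset) blast+
    then show "linear_order_on X (Restr M X)" "Q (Restr M X)" using r by blast+
  qed
  have "Q S" if S: "finite S" "S \<subseteq> M" for S
  proof -
    have "finite (Field S)" "Field S \<subseteq> \<Omega>" "S \<subseteq> Restr M (Field S)"
      using S sub finite_Field[OF S(1)] by (auto simp: Field_def)
    then show ?thesis using Restr(2) finite_character_antimono[OF Q] by blast
  qed
  then have "Q M" using Q unfolding finite_character_def by blast
  moreover have "linear_order_on \<Omega> M"
    using sub Restr(1) by (rule linear_order_on_if_finite_Restr)
  ultimately show ?thesis by blast
qed

subsection \<open>Convexity\<close>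

lemma convex_inD:
  "convex_in r A \<Longrightarrow> p \<in> A \<Longrightarrow> s \<in> A \<Longrightarrow> (p, q) \<in> r \<Longrightarrow> (q, s) \<in> r \<Longrightarrow> q \<in> A"
  unfolding convex_in_def by blast

lemma convex_in_converse [simp]: "convex_in (r\<inverse>) A \<longleftrightarrow> convex_in r A"
  unfolding convex_in_def by blast

lemma convex_in_vimage:
  assumes "\<And>p q. (p, q) \<in> r \<Longrightarrow> (f p, f q) \<in> s" "convex_in s A"
  shows "convex_in r (f -` A)"
  using assms unfolding convex_in_def vimage_def mem_Collect_eq by meson

lemma convex_in_Int:
  assumes "r \<subseteq> X \<times> X"
  shows "convex_in r (X \<inter> A) \<longleftrightarrow> convex_in r A"
  using assms unfolding convex_in_def by blast

lemma convex_in_subsingleton: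
  assumes "linear_order_on X r" "A \<subseteq> {z}"
  shows "convex_in r A"
  using assms(2) linear_order_on_antisym[OF assms(1)] unfolding convex_in_def by blast

lemma convex_in_Diff_extremum:
  assumes r: "linear_order_on X r" and A: "convex_in r A"
    and "(\<forall>a\<in>A. (a, x) \<in> r) \<or> (\<forall>a\<in>A. (x, a) \<in> r)"
  shows "convex_in r (A - {x})"
  unfolding convex_in_def
proof (intro allI impI)
  fix p q s assume pqs: "p \<in> A - {x}" "s \<in> A - {x}" "(p, q) \<in> r" "(q, s) \<in> r"
  then have "q \<in> A" by (blast dest: convex_inD[OF A])
  moreover have "q \<noteq> x" using pqs assms(3) linear_order_on_antisym[OF r] by blast
  ultimately show "q \<in> A - {x}" by blast
qed

definition abuts :: "'a rel \<Rightarrow> 'a \<Rightarrow> 'a set \<Rightarrow> bool" where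
  "abuts r x I \<longleftrightarrow> I \<noteq> {} \<and> x \<notin> I \<and> convex_in r I \<and> convex_in r (insert x I)"

lemma abuts_converse [simp]: "abuts (r\<inverse>) x I \<longleftrightarrow> abuts r x I"
  unfolding abuts_def by simp

lemma abuts_one_side:
  assumes r: "linear_order_on X r" "x \<in> X" "I \<subseteq> X" and "abuts r x I"
  shows "I \<subseteq> underS r x \<or> I \<subseteq> aboveS r x"
proof (rule ccontr)
  assume "\<not> ?thesis"
  then obtain i j where "i \<in> I" "i \<notin> underS r x" "j \<in> I" "j \<notin> aboveS r x" by blast
  moreover from this have "i \<in> aboveS r x" "j \<in> underS r x"
    using assms linear_order_on_total[OF r(1)] unfolding abuts_def underS_def aboveS_def by blast+
  ultimately show False
    using \<open>abuts r x I\<close> convex_inD[of r I j i x] unfolding abuts_def underS_def aboveS_def by blast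
qed

lemma abuts_underS_meet:
  assumes r: "linear_order_on X r" "I \<subseteq> X" "J \<subseteq> X"
    and "abuts r x I" "I \<subseteq> underS r x" "abuts r x J" "J \<subseteq> underS r x"
  shows "I \<inter> J \<noteq> {}"
proof -
  obtain i j where ij: "i \<in> I" "j \<in> J" using assms unfolding abuts_def by blast
  then have below: "(i, x) \<in> r" "i \<noteq> x" "(j, x) \<in> r" "j \<noteq> x"
    using assms unfolding underS_def by blast+
  consider (le) "(i, j) \<in> r" | (ge) "(j, i) \<in> r"
    using ij r(2,3) linear_order_on_total[OF r(1)] by blast
  then show ?thesis
  proof cases
    case le
    then have "j \<in> insert x I"
      using ij below \<open>abuts r x I\<close> convex_inD[of r "insert x I" i x j] unfolding abuts_def by blast
    then show ?thesis using ij below by blast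
  next
    case ge
    then have "i \<in> insert x J"
      using ij below \<open>abuts r x J\<close> convex_inD[of r "insert x J" j x i] unfolding abuts_def by blast
    then show ?thesis using ij below by blast
  qed
qed

lemma abuts_meet_iff_same_side:
  assumes r: "linear_order_on X r" "x \<in> X"
    and I: "I \<subseteq> X" "abuts r x I" and J: "J \<subseteq> X" "abuts r x J"
  shows "I \<inter> J \<noteq> {} \<longleftrightarrow> (I \<subseteq> underS r x \<longleftrightarrow> J \<subseteq> underS r x)"
proof -
  have sides: "I \<subseteq> underS r x \<or> I \<subseteq> aboveS r x" "J \<subseteq> underS r x \<or> J \<subseteq> aboveS r x"
    using abuts_one_side[OF r] I J by blast+
  have "I \<inter> J \<noteq> {}" if "I \<subseteq> underS r x" "J \<subseteq> underS r x"
    using abuts_underS_meet[OF r(1)] I J that by blast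
  moreover have "I \<inter> J \<noteq> {}" if "I \<subseteq> aboveS r x" "J \<subseteq> aboveS r x"
    using abuts_underS_meet[of X "r\<inverse>" I J x] r(1) I J that by simp
  moreover have "I \<noteq> {}" "J \<noteq> {}" using I J unfolding abuts_def by blast+
  ultimately show ?thesis
    using sides underS_Int_aboveS[OF r(1), of x] by blast
qed

lemma insert_after_collapse:
  assumes r: "linear_order_on X r" "x \<in> X" "y \<notin> X" and "(p, q) \<in> insert_after r x y"
  shows "((id(y := x)) p, (id(y := x)) q) \<in> r"
proof -
  have "(x, x) \<in> r" by (rule linear_order_on_refl[OF r(1,2)])
  moreover have "p \<noteq> y" "q \<noteq> y" if "(p, q) \<in> r"
    using that linear_order_on_subset[OF r(1)] r(3) by blast+
  ultimately show ?thesis using assms(4) by (auto simp: insert_after_iff)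
qed

lemma convex_in_insert_after:
  assumes r: "linear_order_on X r" "x \<in> X" "y \<notin> X" and "convex_in r B"
  shows "convex_in (insert_after r x y) (if x \<in> B then insert y B else B - {y})"
proof -
  have "convex_in (insert_after r x y) (id(y := x) -` B)"
    using insert_after_collapse[OF r] assms(4) by (rule convex_in_vimage)
  moreover have "id(y := x) -` B = (if x \<in> B then insert y B else B - {y})"
    by (auto split: if_splits)
  ultimately show ?thesis by simp
qed

lemma convex_in_insert_after_if_below:
  assumes r: "linear_order_on X r" "x \<in> X" "y \<notin> X"
    and B: "convex_in r B" "x \<in> B" "y \<notin> B" "B - {x} \<subseteq> underS r x"
  shows "convex_in (insert_after r x y) B"
proof -
  have "\<forall>b\<in>insert y B. (b, y) \<in> insert_after r x y"
    using B(4) linear_order_on_refl[OF r(1,2)] unfolding insert_after_iff underS_def by blast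
  then have "convex_in (insert_after r x y) (insert y B - {y})"
    using convex_in_insert_after[OF r B(1)] B(2)
    by (intro convex_in_Diff_extremum[OF linear_order_on_insert_after[OF r]]) auto
  then show ?thesis using B(3) by simp
qed

lemma convex_in_insert_after_if_above:
  assumes r: "linear_order_on X r" "x \<in> X" "y \<notin> X"
    and B: "convex_in r (insert x B)" "y \<in> B" "x \<notin> B" "B - {y} \<subseteq> aboveS r x"
  shows "convex_in (insert_after r x y) B"
proof -
  have "\<forall>b\<in>insert x B. (x, b) \<in> insert_after r x y"
    using B(4) linear_order_on_refl[OF r(1,2)] unfolding insert_after_iff aboveS_def by blast
  then have "convex_in (insert_after r x y) (insert x B - {x})"
    using convex_in_insert_after[OF r B(1)] B(2)
    by (intro convex_in_Diff_extremum[OF linear_order_on_insert_after[OF r]])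
      (auto simp: insert_absorb)
  then show ?thesis using B(3) by simp
qed

lemma finite_character_convex_in: "finite_character (\<lambda>r. \<forall>A\<in>\<P>. convex_in r A)"
  unfolding finite_character_def
proof (intro allI iffI impI ballI)
  fix r F :: "'a rel" and A
  assume "\<forall>A\<in>\<P>. convex_in r A" "F \<subseteq> r" "A \<in> \<P>"
  then show "convex_in F A" unfolding convex_in_def by blast
next
  fix r :: "'a rel" and A
  assume conv: "\<forall>F. finite F \<longrightarrow> F \<subseteq> r \<longrightarrow> (\<forall>A\<in>\<P>. convex_in F A)" and "A \<in> \<P>"
  show "convex_in r A"
    unfolding convex_in_def
  proof (intro allI impI)
    fix p q s assume "p \<in> A" "s \<in> A" "(p, q) \<in> r" "(q, s) \<in> r"
    moreover from this have "convex_in {(p, q), (q, s)} A" using conv \<open>A \<in> \<P>\<close> by simp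
    ultimately show "q \<in> A" by (blast dest: convex_inD)
  qed
qed

definition orderable :: "'a set \<Rightarrow> 'a set set \<Rightarrow> bool" where
  "orderable X \<P> \<longleftrightarrow> (\<exists>r. linear_order_on X r \<and> (\<forall>A\<in>\<P>. convex_in r A))"

lemma orderable_trace_iff: "orderable X ((\<inter>) X ` \<P>) \<longleftrightarrow> orderable X \<P>"
proof -
  have "(\<forall>A\<in>(\<inter>) X ` \<P>. convex_in r A) \<longleftrightarrow> (\<forall>A\<in>\<P>. convex_in r A)" if "linear_order_on X r" for r
    using convex_in_Int[OF linear_order_on_subset[OF that]] by simp
  then show ?thesis unfolding orderable_def by metis
qed

lemma orderable_compactness:
  assumes "\<And>X. finite X \<Longrightarrow> X \<subseteq> \<Omega> \<Longrightarrow> orderable X \<P>"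
  shows "orderable \<Omega> \<P>"
  using assms unfolding orderable_def
  by (rule linear_order_on_compactness[OF finite_character_convex_in])

subsection \<open>Patchworks and tripods\<close>

definition tripod_free :: "'a set set \<Rightarrow> bool" where
  "tripod_free \<P> \<longleftrightarrow>
     (\<forall>D\<in>\<P>. \<forall>E\<in>\<P>. \<forall>F\<in>\<P>. D \<inter> E \<subseteq> F \<or> E \<inter> F \<subseteq> D \<or> D \<inter> F \<subseteq> E)"

lemma tripod_freeD:
  assumes "tripod_free \<P>" "D \<in> \<P>" "E \<in> \<P>" "F \<in> \<P>"
  shows "D \<inter> E \<subseteq> F \<or> E \<inter> F \<subseteq> D \<or> D \<inter> F \<subseteq> E"
  using assms unfolding tripod_free_def by blast

lemma tripod_free_trace:
  assumes "tripod_free \<P>"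
  shows "tripod_free ((\<inter>) X ` \<P>)"
  unfolding tripod_free_def ball_simps
proof (intro ballI)
  fix D E F assume "D \<in> \<P>" "E \<in> \<P>" "F \<in> \<P>"
  with tripod_freeD[OF assms, of D E F]
  show "(X \<inter> D) \<inter> (X \<inter> E) \<subseteq> X \<inter> F \<or> (X \<inter> E) \<inter> (X \<inter> F) \<subseteq> X \<inter> D \<or>
      (X \<inter> D) \<inter> (X \<inter> F) \<subseteq> X \<inter> E"
    by blast
qed

lemma tripod_free_if_orderable:
  assumes "\<P> \<subseteq> Pow X" "orderable X \<P>"
  shows "tripod_free \<P>"
  unfolding tripod_free_def
proof (intro ballI, rule ccontr)
  fix D E F assume P: "D \<in> \<P>" "E \<in> \<P>" "F \<in> \<P>"
    and "\<not> (D \<inter> E \<subseteq> F \<or> E \<inter> F \<subseteq> D \<or> D \<inter> F \<subseteq> E)"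
  then obtain a b c where abc: "a \<in> D \<inter> E - F" "b \<in> E \<inter> F - D" "c \<in> D \<inter> F - E" by blast
  obtain r where r: "linear_order_on X r" and conv: "\<And>A. A \<in> \<P> \<Longrightarrow> convex_in r A"
    using assms(2) unfolding orderable_def by blast
  have "a \<in> X" "b \<in> X" "c \<in> X" using abc P assms(1) by blast+
  then have "(a, b) \<in> r \<or> (b, a) \<in> r" "(b, c) \<in> r \<or> (c, b) \<in> r" "(a, c) \<in> r \<or> (c, a) \<in> r"
    using linear_order_on_total[OF r] by metis+
  moreover have "\<not> ((b, a) \<in> r \<and> (a, c) \<in> r)" "\<not> ((c, a) \<in> r \<and> (a, b) \<in> r)"
    using abc convex_inD[OF conv[OF P(3)]] by blast+
  moreover have "\<not> ((a, b) \<in> r \<and> (b, c) \<in> r)" "\<not> ((c, b) \<in> r \<and> (b, a) \<in> r)"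
    using abc convex_inD[OF conv[OF P(1)]] by blast+
  moreover have "\<not> ((a, c) \<in> r \<and> (c, b) \<in> r)" "\<not> ((b, c) \<in> r \<and> (c, a) \<in> r)"
    using abc convex_inD[OF conv[OF P(2)]] by blast+
  ultimately show False by blast
qed

lemma patchwork_Int:
  assumes "patchwork \<Omega> \<P>" "A \<in> \<P>" "B \<in> \<P>"
  shows "A \<inter> B \<in> \<P>"
proof -
  consider "A \<inter> B = {}" | "A \<inter> B = A" | "A \<inter> B = B" | "overlap A B"
    unfolding overlap_def by blast
  then show ?thesis using assms unfolding patchwork_def by cases simp_all
qed

lemma patchwork_Un:
  assumes "patchwork \<Omega> \<P>" "A \<in> \<P>" "B \<in> \<P>" "A \<inter> B \<noteq> {}"
  shows "A \<union> B \<in> \<P>"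
proof -
  consider "A \<union> B = A" | "A \<union> B = B" | "overlap A B"
    using assms(4) unfolding overlap_def by blast
  then show ?thesis using assms unfolding patchwork_def by cases simp_all
qed

lemma patchwork_Diff:
  assumes "patchwork \<Omega> \<P>" "A \<in> \<P>" "B \<in> \<P>" "\<not> B \<subseteq> A"
  shows "A - B \<in> \<P>"
proof -
  consider "A - B = {}" | "A - B = A" | "overlap A B"
    using assms(4) unfolding overlap_def by blast
  then show ?thesis using assms(1-3) unfolding patchwork_def by cases metis+
qed

lemma patchwork_trace:
  assumes P: "patchwork \<Omega> \<P>" and "X \<subseteq> \<Omega>"
  shows "patchwork X ((\<inter>) X ` \<P>)"
  unfolding patchwork_def
proof (intro conjI)
  have "{} \<in> \<P>" "\<Omega> \<in> \<P>" using P unfolding patchwork_def by blast+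
  moreover have "X \<inter> {} = {}" "X \<inter> \<Omega> = X" using \<open>X \<subseteq> \<Omega>\<close> by blast+
  ultimately show "{} \<in> (\<inter>) X ` \<P>" "X \<in> (\<inter>) X ` \<P>" by (metis imageI)+
  show "\<forall>S\<in>(\<inter>) X ` \<P>. \<forall>T\<in>(\<inter>) X ` \<P>. overlap S T \<longrightarrow>
      S \<inter> T \<in> (\<inter>) X ` \<P> \<and> S \<union> T \<in> (\<inter>) X ` \<P> \<and> S - T \<in> (\<inter>) X ` \<P>"
    unfolding ball_simps
  proof (intro ballI impI)
    fix A B assume AB: "A \<in> \<P>" "B \<in> \<P>" and "overlap (X \<inter> A) (X \<inter> B)"
    then have "A \<inter> B \<noteq> {}" "\<not> B \<subseteq> A" unfolding overlap_def by blast+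
    then have "A \<inter> B \<in> \<P>" "A \<union> B \<in> \<P>" "A - B \<in> \<P>"
      using patchwork_Int[OF P] patchwork_Un[OF P] patchwork_Diff[OF P] AB by blast+
    moreover have "(X \<inter> A) \<inter> (X \<inter> B) = X \<inter> (A \<inter> B)" "(X \<inter> A) \<union> (X \<inter> B) = X \<inter> (A \<union> B)"
      "(X \<inter> A) - (X \<inter> B) = X \<inter> (A - B)" by blast+
    ultimately show "(X \<inter> A) \<inter> (X \<inter> B) \<in> (\<inter>) X ` \<P> \<and> (X \<inter> A) \<union> (X \<inter> B) \<in> (\<inter>) X ` \<P> \<and>
        (X \<inter> A) - (X \<inter> B) \<in> (\<inter>) X ` \<P>"
      by simp
  qed
qed blast

lemma patchwork_petals_adjacent:
  assumes P: "patchwork \<Omega> \<P>" "D \<in> \<P>" "E \<in> \<P>" "F \<in> \<P>" and "\<not> D \<inter> F \<subseteq> E"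
  shows "adjacent \<P> (D \<inter> E - F) (E \<inter> F - D)"
  unfolding adjacent_def
proof (intro conjI)
  show "D \<inter> E - F \<in> \<P>" "E \<inter> F - D \<in> \<P>"
    using P assms(5) by (intro patchwork_Diff[OF P(1)] patchwork_Int[OF P(1)]; blast)+
  have "E \<inter> (D \<union> F) - D \<inter> F \<in> \<P>"
    using P assms(5)
    by (intro patchwork_Diff[OF P(1)] patchwork_Int[OF P(1)] patchwork_Un[OF P(1)]) blast+
  moreover have "(D \<inter> E - F) \<union> (E \<inter> F - D) = E \<inter> (D \<union> F) - D \<inter> F" by blast
  ultimately show "(D \<inter> E - F) \<union> (E \<inter> F - D) \<in> \<P>" by simp
qed blast

lemma patchwork_tripod_free_iff_no_adjacent_triple:
  assumes P: "patchwork \<Omega> \<P>"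
  shows "tripod_free \<P> \<longleftrightarrow>
         \<not> (\<exists>A\<in>\<P>. \<exists>B\<in>\<P>. \<exists>C\<in>\<P>. A \<noteq> {} \<and> B \<noteq> {} \<and> C \<noteq> {} \<and>
              adjacent \<P> A B \<and> adjacent \<P> B C \<and> adjacent \<P> A C)"
    (is "_ \<longleftrightarrow> ?no_triple")
proof
  assume ?no_triple
  show "tripod_free \<P>"
    unfolding tripod_free_def
  proof (intro ballI, rule ccontr)
    fix D E F assume "D \<in> \<P>" "E \<in> \<P>" "F \<in> \<P>"
      and tripod: "\<not> (D \<inter> E \<subseteq> F \<or> E \<inter> F \<subseteq> D \<or> D \<inter> F \<subseteq> E)"
    then have "adjacent \<P> (D \<inter> E - F) (E \<inter> F - D)" "adjacent \<P> (E \<inter> F - D) (F \<inter> D - E)"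
      "adjacent \<P> (E \<inter> D - F) (D \<inter> F - E)"
      by (intro patchwork_petals_adjacent[OF P]; blast)+
    then have "adjacent \<P> (D \<inter> E - F) (E \<inter> F - D)" "adjacent \<P> (E \<inter> F - D) (D \<inter> F - E)"
      "adjacent \<P> (D \<inter> E - F) (D \<inter> F - E)"
      by (simp_all only: Int_commute)
    moreover from this have "D \<inter> E - F \<in> \<P>" "E \<inter> F - D \<in> \<P>" "D \<inter> F - E \<in> \<P>"
      unfolding adjacent_def by blast+
    moreover have "D \<inter> E - F \<noteq> {}" "E \<inter> F - D \<noteq> {}" "D \<inter> F - E \<noteq> {}" using tripod by blast+
    ultimately show False using \<open>?no_triple\<close> by metis
  qed
next
  assume "tripod_free \<P>"
  show ?no_triple
  proof clarify
    fix A B C assume ne: "A \<noteq> {}" "B \<noteq> {}" "C \<noteq> {}"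
      and "adjacent \<P> A B" "adjacent \<P> B C" "adjacent \<P> A C"
    then have "A \<union> B \<in> \<P>" "B \<union> C \<in> \<P>" "A \<union> C \<in> \<P>" "A \<inter> B = {}" "B \<inter> C = {}" "A \<inter> C = {}"
      unfolding adjacent_def by blast+
    then show False
      using tripod_freeD[OF \<open>tripod_free \<P>\<close>, of "A \<union> B" "B \<union> C" "A \<union> C"] ne by blast
  qed
qed

lemma tripod_free_meet_outside:
  assumes P: "patchwork \<Omega> \<P>" "tripod_free \<P>" "A \<in> \<P>" "B \<in> \<P>" "C \<in> \<P>"
    and "overlap A B" "overlap A C" "A \<inter> B \<inter> C \<noteq> {}" "\<not> A \<subseteq> B \<union> C"
  shows "\<not> B \<inter> C \<subseteq> A"
proof
  assume sub: "B \<inter> C \<subseteq> A"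
  have "A \<union> B \<in> \<P>" "A \<union> C \<in> \<P>" "B \<union> C \<in> \<P>"
    using assms unfolding overlap_def by (blast intro: patchwork_Un[OF P(1)])+
  from tripod_freeD[OF P(2) this] show False
    using assms(6-9) sub unfolding overlap_def by blast
qed

lemma tripod_free_disjoint_outside:
  assumes "tripod_free \<P>" "A \<in> \<P>" "B \<in> \<P>" "C \<in> \<P>"
    and "overlap A B" "overlap A C" "A \<inter> B \<inter> C = {}"
  shows "B \<inter> C \<subseteq> A"
  using tripod_freeD[OF assms(1-4)] assms(5-) unfolding overlap_def by blast

lemma tripod_free_doubleton_meet_outside_iff:
  assumes P: "patchwork \<Omega> \<P>" "tripod_free \<P>" "{x, y} \<in> \<P>" "B \<in> \<P>" "C \<in> \<P>"
    and overlap: "overlap {x, y} B" "overlap {x, y} C"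
  shows "\<not> B \<inter> C \<subseteq> {x, y} \<longleftrightarrow> (x \<in> B \<longleftrightarrow> x \<in> C)"
proof (cases "{x, y} \<inter> B \<inter> C = {}")
  case True
  then show ?thesis
    using tripod_free_disjoint_outside[OF P(2-) overlap] overlap unfolding overlap_def by blast
next
  case False
  then have "\<not> {x, y} \<subseteq> B \<union> C" "x \<in> B \<longleftrightarrow> x \<in> C" using overlap unfolding overlap_def by blast+
  then show ?thesis using tripod_free_meet_outside[OF P overlap False] by blast
qed

subsection \<open>Finite patchworks\<close>

lemma patchwork_minimal_separated:
  assumes P: "patchwork \<Omega> \<P>" "A \<in> \<P>" "B \<in> \<P>"
    and minimal: "\<And>C. C \<in> \<P> \<Longrightarrow> C \<subset> A \<Longrightarrow> \<exists>z. C \<subseteq> {z}"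
    and xy: "x \<in> A \<inter> B" "y \<in> A - B"
  shows "B = {x} \<or> A = {x, y}"
proof -
  have "A \<inter> B \<subset> A" using xy by blast
  then have x: "A \<inter> B = {x}"
    using minimal[OF patchwork_Int[OF P]] xy by blast
  show ?thesis
  proof (cases "B \<subseteq> A")
    case True
    then show ?thesis using x by blast
  next
    case False
    have "A - B \<subset> A" using xy by blast
    then have "A - B = {y}"
      using minimal[OF patchwork_Diff[OF P False]] xy by blast
    then show ?thesis using x by blast
  qed
qed

definition minimal_pair :: "'a set set \<Rightarrow> 'a \<Rightarrow> 'a \<Rightarrow> bool" where
  "minimal_pair \<P> x y \<longleftrightarrow> x \<noteq> y \<and> ({x, y} \<in> \<P> \<or> (\<forall>B\<in>\<P>. \<not> overlap {x, y} B))"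

lemma patchwork_ex_minimal_pair:
  assumes X: "finite X" "\<nexists>z. X \<subseteq> {z}" and P: "patchwork X \<P>"
  obtains x y where "x \<in> X" "y \<in> X" "minimal_pair \<P> x y"
proof -
  let ?big = "{A \<in> \<P>. \<nexists>z. A \<subseteq> {z}}"
  have sub: "\<P> \<subseteq> Pow X" and "X \<in> ?big" using P X(2) unfolding patchwork_def by blast+
  have "finite ?big"
    by (rule finite_subset[of _ "Pow X"]) (use sub X(1) in auto)
  with \<open>X \<in> ?big\<close> obtain A where A: "A \<in> ?big" and "\<forall>B\<in>?big. B \<subseteq> A \<longrightarrow> A = B"
    using finite_has_minimal[of ?big] by blast
  then have minimal: "\<And>C. C \<in> \<P> \<Longrightarrow> C \<subset> A \<Longrightarrow> \<exists>z. C \<subseteq> {z}" by blast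
  obtain x where x: "x \<in> A" using A by blast
  obtain y where y: "y \<in> A" "x \<noteq> y" using A by blast
  have "{x, y} \<in> \<P>" if B: "B \<in> \<P>" "overlap {x, y} B" for B
  proof -
    consider "x \<in> A \<inter> B" "y \<in> A - B" "B \<noteq> {x}" | "y \<in> A \<inter> B" "x \<in> A - B" "B \<noteq> {y}"
      using B(2) x y unfolding overlap_def by blast
    then have "A = {x, y}"
      using A B(1) by cases (blast dest: patchwork_minimal_separated[OF P _ _ minimal])+
    then show ?thesis using A by blast
  qed
  then have "minimal_pair \<P> x y" using y(2) unfolding minimal_pair_def by blast
  then show thesis using that x y(1) A sub by blast
qed

lemma abuts_if_overlap_doubleton:
  assumes P: "patchwork \<Omega> \<P>" "{x, y} \<in> \<P>" "B \<in> \<P>" and overlap: "overlap {x, y} B"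
    and r: "r \<subseteq> Y \<times> Y" "y \<notin> Y" and conv: "\<forall>A\<in>\<P>. convex_in r A"
  shows "abuts r x (B - {x, y})"
  unfolding abuts_def
proof (intro conjI)
  show "B - {x, y} \<noteq> {}" "x \<notin> B - {x, y}" using overlap unfolding overlap_def by blast+
  have "B - {x, y} \<in> \<P>" "{x, y} \<union> B \<in> \<P>"
    using P overlap unfolding overlap_def by (blast intro: patchwork_Diff patchwork_Un)+
  then have conv: "convex_in r (B - {x, y})" "convex_in r ({x, y} \<union> B)" using conv by blast+
  show "convex_in r (B - {x, y})" by (rule conv)
  have "Y \<inter> ({x, y} \<union> B) = Y \<inter> insert x (B - {x, y})" using r(2) by blast
  then show "convex_in r (insert x (B - {x, y}))" using conv(2) convex_in_Int[OF r(1)] by metis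
qed

lemma overlap_doubleton_one_side:
  assumes P: "patchwork X \<P>" "{x, y} \<in> \<P>" "B \<in> \<P>" "overlap {x, y} B"
    and r: "linear_order_on (X - {y}) r" and conv: "\<forall>A\<in>\<P>. convex_in r A"
  shows "B - {x, y} \<subseteq> underS r x \<or> B - {x, y} \<subseteq> aboveS r x"
proof (rule abuts_one_side[OF r])
  show "x \<in> X - {y}" "B - {x, y} \<subseteq> X - {y}"
    using P unfolding patchwork_def overlap_def by blast+
  show "abuts r x (B - {x, y})"
    using conv by (intro abuts_if_overlap_doubleton[OF P linear_order_on_subset[OF r]]) auto
qed

lemma overlap_doubleton_same_side_iff:
  assumes P: "patchwork X \<P>" "tripod_free \<P>" "{x, y} \<in> \<P>"
    and B: "B \<in> \<P>" "overlap {x, y} B" and C: "C \<in> \<P>" "overlap {x, y} C"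
    and r: "linear_order_on (X - {y}) r" and conv: "\<forall>A\<in>\<P>. convex_in r A"
  shows "(B - {x, y} \<subseteq> underS r x \<longleftrightarrow> C - {x, y} \<subseteq> underS r x) \<longleftrightarrow> (x \<in> B \<longleftrightarrow> x \<in> C)"
proof -
  have "x \<in> X - {y}" "B - {x, y} \<subseteq> X - {y}" "C - {x, y} \<subseteq> X - {y}"
    using P(1,3) B C unfolding patchwork_def overlap_def by blast+
  moreover have "abuts r x (B - {x, y})" "abuts r x (C - {x, y})"
    using conv B C
    by (auto intro!: abuts_if_overlap_doubleton[OF P(1,3) _ _ linear_order_on_subset[OF r]])
  ultimately have "(B - {x, y} \<subseteq> underS r x \<longleftrightarrow> C - {x, y} \<subseteq> underS r x) \<longleftrightarrow>
      (B - {x, y}) \<inter> (C - {x, y}) \<noteq> {}"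
    by (intro abuts_meet_iff_same_side[OF r, symmetric])
  also have "\<dots> \<longleftrightarrow> \<not> B \<inter> C \<subseteq> {x, y}" by blast
  also have "\<dots> \<longleftrightarrow> (x \<in> B \<longleftrightarrow> x \<in> C)"
    by (rule tripod_free_doubleton_meet_outside_iff[OF P B(1) C(1) B(2) C(2)])
  finally show ?thesis .
qed

text \<open>The condition on \<open>r\<close> under which \<open>y\<close> can be inserted immediately after \<open>x\<close>.\<close>

definition oriented :: "'a set set \<Rightarrow> 'a rel \<Rightarrow> 'a \<Rightarrow> 'a \<Rightarrow> bool" where
  "oriented \<P> r x y \<longleftrightarrow>
     (\<forall>B\<in>\<P>. overlap {x, y} B \<longrightarrow>
       (if x \<in> B then B - {x, y} \<subseteq> underS r x else B - {x, y} \<subseteq> aboveS r x))"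

lemma oriented_or_oriented_converse:
  assumes P: "patchwork X \<P>" "tripod_free \<P>" "minimal_pair \<P> x y"
    and r: "linear_order_on (X - {y}) r" and conv: "\<forall>A\<in>\<P>. convex_in r A"
  shows "oriented \<P> r x y \<or> oriented \<P> (r\<inverse>) x y"
proof (rule disjCI)
  let ?left = "\<lambda>B. B - {x, y} \<subseteq> underS r x" and ?right = "\<lambda>B. B - {x, y} \<subseteq> aboveS r x"
  assume "\<not> oriented \<P> (r\<inverse>) x y"
  then obtain B where B: "B \<in> \<P>" "overlap {x, y} B" "\<not> (if x \<in> B then ?right B else ?left B)"
    unfolding oriented_def underS_converse aboveS_converse by meson
  then have xy: "{x, y} \<in> \<P>" using P(3) unfolding minimal_pair_def by blast
  have sides: "?left C \<or> ?right C" if "C \<in> \<P>" "overlap {x, y} C" for C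
    by (rule overlap_doubleton_one_side[OF P(1) xy that r conv])
  have "if x \<in> C then ?left C else ?right C" if C: "C \<in> \<P>" "overlap {x, y} C" for C
    using overlap_doubleton_same_side_iff[OF P(1,2) xy B(1,2) C r conv] B(3)
      sides[OF B(1,2)] sides[OF C]
    by argo
  then show "oriented \<P> r x y" unfolding oriented_def by meson
qed

lemma ex_oriented:
  assumes P: "patchwork X \<P>" "tripod_free \<P>" "minimal_pair \<P> x y" and "orderable (X - {y}) \<P>"
  obtains r where "linear_order_on (X - {y}) r" "\<forall>A\<in>\<P>. convex_in r A" "oriented \<P> r x y"
proof -
  obtain r where r: "linear_order_on (X - {y}) r" "\<forall>A\<in>\<P>. convex_in r A"
    using assms(4) unfolding orderable_def by blast
  from oriented_or_oriented_converse[OF P this] show thesis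
    using that[OF r] that[of "r\<inverse>"] r by auto
qed

lemma convex_in_insert_after_minimal_pair:
  assumes P: "patchwork X \<P>" "minimal_pair \<P> x y" and "x \<in> X"
    and r: "linear_order_on (X - {y}) r" and conv: "\<forall>A\<in>\<P>. convex_in r A"
    and oriented: "oriented \<P> r x y" and B: "B \<in> \<P>"
  shows "convex_in (insert_after r x y) B"
proof -
  have x: "x \<in> X - {y}" and y: "y \<notin> X - {y}"
    using P(2) \<open>x \<in> X\<close> unfolding minimal_pair_def by blast+
  have side: "if x \<in> B then B - {x, y} \<subseteq> underS r x else B - {x, y} \<subseteq> aboveS r x"
    if "overlap {x, y} B"
    using oriented B that unfolding oriented_def by blast
  have convB: "convex_in r B" using conv B by blast
  consider (subsingleton) z where "B \<subseteq> {z}" | (inseparable) "x \<in> B \<longleftrightarrow> y \<in> B"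
    | (below) "overlap {x, y} B" "x \<in> B" "y \<notin> B" | (above) "overlap {x, y} B" "y \<in> B" "x \<notin> B"
    unfolding overlap_def by blast
  then show ?thesis
  proof cases
    case subsingleton
    then show ?thesis by (rule convex_in_subsingleton[OF linear_order_on_insert_after[OF r x y]])
  next
    case inseparable
    then show ?thesis
      using convex_in_insert_after[OF r x y convB] by (auto simp: insert_absorb split: if_splits)
  next
    case below
    then have "B - {x} \<subseteq> underS r x" using side by auto
    then show ?thesis by (rule convex_in_insert_after_if_below[OF r x y convB below(2,3)])
  next
    case above
    then have "{x, y} \<in> \<P>" using P(2) B unfolding minimal_pair_def by blast
    then have "{x, y} \<union> B \<in> \<P>" using above(2) by (intro patchwork_Un[OF P(1) _ B]) auto
    then have "convex_in r (insert x B)" using conv above(2) by (simp add: insert_absorb)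
    moreover have "B - {y} \<subseteq> aboveS r x" using side above by auto
    ultimately show ?thesis by (intro convex_in_insert_after_if_above[OF r x y _ above(2,3)])
  qed
qed

lemma orderable_if_minimal_pair:
  assumes P: "patchwork X \<P>" "tripod_free \<P>" "minimal_pair \<P> x y" and xy: "x \<in> X" "y \<in> X"
    and "orderable (X - {y}) \<P>"
  shows "orderable X \<P>"
proof -
  obtain r where r: "linear_order_on (X - {y}) r" "\<forall>A\<in>\<P>. convex_in r A" "oriented \<P> r x y"
    using ex_oriented[OF P assms(6)] by blast
  have "x \<in> X - {y}" "y \<notin> X - {y}" using P(3) xy(1) unfolding minimal_pair_def by blast+
  then have "linear_order_on (insert y (X - {y})) (insert_after r x y)"
    by (rule linear_order_on_insert_after[OF r(1)])
  then have "linear_order_on X (insert_after r x y)" using xy(2) by (simp add: insert_absorb)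
  then show ?thesis
    using convex_in_insert_after_minimal_pair[OF P(1,3) xy(1) r] unfolding orderable_def by blast
qed

lemma orderable_if_finite_tripod_free:
  assumes "finite X" "patchwork X \<P>" "tripod_free \<P>"
  shows "orderable X \<P>"
  using assms
proof (induction X arbitrary: \<P> rule: finite_psubset_induct)
  case (psubset X)
  show ?case
  proof (cases "\<exists>z. X \<subseteq> {z}")
    case True
    then obtain z where "X \<subseteq> {z}" by blast
    then have "A \<subseteq> {z}" if "A \<in> \<P>" for A
      using psubset.prems(1) that unfolding patchwork_def by blast
    moreover obtain r where "linear_order_on X r"
      using well_order_on unfolding well_order_on_def by blast
    ultimately show ?thesis
      unfolding orderable_def by (blast intro: convex_in_subsingleton)
  next
    case False
    then obtain x y where xy: "x \<in> X" "y \<in> X" and pair: "minimal_pair \<P> x y"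
      using patchwork_ex_minimal_pair[OF psubset.hyps False psubset.prems(1)] by blast
    have "orderable (X - {y}) ((\<inter>) (X - {y}) ` \<P>)"
      using xy(2) psubset.prems
      by (intro psubset.IH patchwork_trace[of X] tripod_free_trace) blast+
    then have "orderable (X - {y}) \<P>" by (simp only: orderable_trace_iff)
    then show ?thesis by (rule orderable_if_minimal_pair[OF psubset.prems pair xy])
  qed
qed

lemma patchwork_orderable_iff_tripod_free:
  assumes P: "patchwork \<Omega> \<P>"
  shows "orderable \<Omega> \<P> \<longleftrightarrow> tripod_free \<P>"
proof
  show "tripod_free \<P>" if "orderable \<Omega> \<P>"
    using P that unfolding patchwork_def by (blast intro: tripod_free_if_orderable)
  show "orderable \<Omega> \<P>" if "tripod_free \<P>"
  proof (rule orderable_compactness)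
    fix X assume "finite X" "X \<subseteq> \<Omega>"
    then have "orderable X ((\<inter>) X ` \<P>)"
      by (intro orderable_if_finite_tripod_free patchwork_trace[OF P] tripod_free_trace[OF that])
    then show "orderable X \<P>" by (simp only: orderable_trace_iff)
  qed
qed

theorem theorem5p1:
  fixes \<Omega> :: "'a set" and \<P> :: "'a set set"
  assumes "patchwork \<Omega> \<P>"
  shows "(\<exists>r. linear_order_on \<Omega> r \<and> (\<forall>A\<in>\<P>. convex_in r A)) \<longleftrightarrow>
         \<not> (\<exists>A\<in>\<P>. \<exists>B\<in>\<P>. \<exists>C\<in>\<P>. A \<noteq> {} \<and> B \<noteq> {} \<and> C \<noteq> {} \<and>
              adjacent \<P> A B \<and> adjacent \<P> B C \<and> adjacent \<P> A C)"
  using patchwork_orderable_iff_tripod_free[OF assms]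
    patchwork_tripod_free_iff_no_adjacent_triple[OF assms]
  unfolding orderable_def by (rule trans)

end
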